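(* Let $\alpha>1$ be real, let $[\alpha]$ be its integer part and $\{\alpha\}=\alpha-[\alpha]$ its fractional part. If $[\alpha]$ is even, then $$\frac{2^\alpha-1}{(2\pi)^{\alpha-1}}\,\Gamma(\alpha)\,\zeta(\alpha)=(-1)^{[\alpha]/2}\int_0^\infty\int_0^\infty \tau^{\{\alpha\}}K_{i\tau}(x)\,e^{-x}\,p_{[\alpha]/2}(x)\,\frac{dx}{x}\,d\tau .$$ If $[\alpha]$ is odd, then $$\frac{2^\alpha-1}{(2\pi)^{\alpha-1}}\,\Gamma(\alpha)\,\zeta(\alpha)=(-1)^{([\alpha]-1)/2}\int_0^\infty\int_0^\infty \tau^{\{\alpha\}-1}K_{i\tau}(x)\,e^{-x}\,p_{([\alpha]+1)/2}(x)\,\frac{dx}{x}\,d\tau .$$ Here $\zeta$ is the Riemann zeta function and $\Gamma$ is Euler's gamma function.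
   Context: $K_\nu$ is the modified Bessel function of the second kind; for $x>0$ and $\tau\in\mathbb R$, $K_{i\tau}(x)=\int_0^\infty e^{-x\cosh u}\cos(\tau u)\,du$. The polynomials $p_n$, $n\ge 0$, are defined by $p_n(x)=(-1)^n e^x\mathcal A^n e^{-x}$, where $\mathcal A$ is the differential operator $\mathcal A f(x)=x^2f(x)-x\frac{d}{dx}\left(x\frac{df}{dx}\right)$; thus $p_0(x)=1$, $p_1(x)=-x$, $p_2(x)=3x^2-x$, $p_3(x)=-15x^3+15x^2-x$.
   Formalization: For odd [α] the sign is corrected from (-1)^{([α]-1)/2} to (-1)^{([α]+1)/2}: as printed the identity is false, e.g. for 1<α<2, where p_1(x)=-x makes the right side negative while the left side is positive. *)

theory Defs
  imports "HOL-Analysis.Analysis"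
begin

(* Dirichlet series; this is the Riemann zeta function only for s > 1. *)
definition riemann_zeta :: "real \<Rightarrow> real" where
  "riemann_zeta s = (\<Sum>n. 1 / real (Suc n) powr s)"

(* besselK_imag \<tau> x is K_{i\<tau>}(x), the modified Bessel function of the second kind of
   purely imaginary order, for x > 0. *)
definition besselK_imag :: "real \<Rightarrow> real \<Rightarrow> real" where
  "besselK_imag \<tau> x = (LINT u:{0..}|lborel. exp (- x * cosh u) * cos (\<tau> * u))"

definition opA :: "(real \<Rightarrow> real) \<Rightarrow> real \<Rightarrow> real" where
  "opA f = (\<lambda>x. x\<^sup>2 * f x - x * deriv (\<lambda>y. y * deriv f y) x)"

definition polyp :: "nat \<Rightarrow> real \<Rightarrow> real" where
  "polyp n x = (-1) ^ n * exp x * (opA ^^ n) (\<lambda>y. exp (- y)) x"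

(* F takes the outer variable first: the inner integral is over x, the outer one over \<tau>.
   The order matters: F need not be integrable on the product
   (e.g. F \<tau> x = \<tau> powr (-1) * besselK_imag \<tau> x * exp (- x) * polyp 2 x / x). *)
definition iterated_integral :: "(real \<Rightarrow> real \<Rightarrow> real) \<Rightarrow> real" where
  "iterated_integral F =
     (LINT \<tau>:{0<..}|lborel. (LINT x:{0<..}|lborel. F \<tau> x))"

(* The Lebesgue integral of a non-integrable function is 0 by convention, so existence of the
   inner and outer integrals has to be stated separately. *)
definition iterated_integrable :: "(real \<Rightarrow> real \<Rightarrow> real) \<Rightarrow> bool" where
  "iterated_integrable F \<longleftrightarrow>
     (\<forall>\<tau>>0. set_integrable lborel {0<..} (F \<tau>)) \<and>
     set_integrable lborel {0<..} (\<lambda>\<tau>. LINT x:{0<..}|lborel. F \<tau> x)"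

end

theory Submission
  imports Defs "HOL-Real_Asymp.Real_Asymp" "HOL-Computational_Algebra.Polynomial"
begin

text \<open>
  The operator \<open>A\<close> is symmetric with respect to the measure \<open>dx / x\<close>, and \<open>A K\<^bsub>i\<tau>\<^esub> = \<tau>\<^sup>2 K\<^bsub>i\<tau>\<^esub>\<close>.  Since
  \<open>exp (- x) p\<^sub>n(x) = (-1)\<^sup>n A\<^sup>n exp (- x)\<close> and \<open>A exp (- x) = x exp (- x)\<close>, moving \<open>n - 1\<close> copies of \<open>A\<close> to
  the Bessel function reduces the inner integral to \<open>(-1)\<^sup>n \<tau>\<^sup>2\<^sup>n\<^sup>-\<^sup>2\<close> times the integral of
  \<open>K\<^bsub>i\<tau>\<^esub>(x) exp (- x)\<close> over \<open>x > 0\<close>, which equals \<open>\<pi> \<tau> / sinh (\<pi> \<tau>)\<close>.  The last copy of \<open>A\<close> has to stay,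
  because \<open>K\<^bsub>i\<tau>\<^esub>(x) exp (- x) / x\<close> is not integrable at \<open>0\<close>.  In both parities the outer integrand is
  then \<open>\<plusminus> \<tau> powr (\<alpha> - 1) \<pi> / sinh (\<pi> \<tau>)\<close>, and expanding \<open>1 / sinh\<close> into exponentials gives
  \<open>\<Gamma>(\<alpha>)\<close> times the Dirichlet series over the odd integers, that is, \<open>(1 - 2 powr (- \<alpha>)) \<zeta>(\<alpha>)\<close>.

  The symmetry argument is carried out on the side of the variable \<open>u\<close> of the integral
  representation of \<open>K\<^bsub>i\<tau>\<^esub>\<close>.  The kernel \<open>exp (- x cosh u)\<close> turns \<open>A\<close> in \<open>x\<close> into minus the second
  derivative in \<open>u\<close>, and \<open>\<tau>\<^sup>2\<close> arises from integrating \<open>cos (\<tau> u)\<close> by parts.  By Fubini's theorem,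
  the integral of \<open>K\<^bsub>i\<tau>\<^esub>(x) x\<^sup>k exp (- x)\<close> is \<open>k!\<close> times the cosine transform of
  \<open>1 / (1 + cosh u)\<^sup>k\<^sup>+\<^sup>1\<close> (\<open>besselK_imag_moment\<close>), so the whole argument becomes a recurrence between
  these transforms (\<open>cosh_cos_transform_rec\<close>), and neither derivatives nor asymptotics of the Bessel
  function enter.  The first transform is evaluated through \<open>\<Gamma>(1 + i \<tau>) \<Gamma>(1 - i \<tau>)\<close>
  (\<open>cosh_cos_transform_1\<close>).
\<close>

section \<open>Euler's integral with an exponential scale\<close>

text \<open>This is Euler's integral rescaled by \<open>t \<mapsto> a t\<close>.  It evaluates the elementary integrals over
  \<open>x\<close> that remain after each use of Fubini's theorem, and at the end the Laplace integrals
  that produce the Dirichlet series.\<close>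

lemma has_bochner_integral_powr_exp:
  fixes s a :: real
  assumes s: "s > 0" and a: "a > 0"
  shows "has_bochner_integral lborel
           (\<lambda>t. indicator {0<..} t * (t powr (s - 1) * exp (- (a * t)))) (Gamma s / a powr s)"
proof -
  let ?f = "\<lambda>t::real. indicator {0..} t * t powr (s - 1) / exp t"
  have "has_bochner_integral lborel ?f (Gamma s)"
    using Gamma_conv_nn_integral_real[OF s] Gamma_real_pos[OF s]
    by (intro has_bochner_integral_nn_integral) auto
  then have "has_bochner_integral lborel (\<lambda>t. ?f (0 + a * t)) (Gamma s /\<^sub>R \<bar>a\<bar>)"
    using a by (subst (asm) lborel_has_bochner_integral_real_affine_iff[where c = a and t = 0]) auto
  then have "has_bochner_integral lborel (\<lambda>t. ?f (0 + a * t) * a powr (1 - s)) (Gamma s /\<^sub>R \<bar>a\<bar> * a powr (1 - s))"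
    by (rule has_bochner_integral_mult_left[rotated])
  moreover have "?f (0 + a * t) * a powr (1 - s) = indicator {0<..} t * (t powr (s - 1) * exp (- (a * t)))" for t
    using a powr_add[of a "s - 1" "1 - s"]
    by (cases "t > 0"; cases "t = 0")
       (auto simp: indicator_def powr_mult exp_minus field_simps zero_le_mult_iff)
  moreover have "Gamma s /\<^sub>R \<bar>a\<bar> * a powr (1 - s) = Gamma s / a powr s"
    using a by (simp add: powr_diff field_simps)
  ultimately show ?thesis by simp
qed

corollary has_bochner_integral_power_exp:
  fixes a :: real
  assumes a: "a > 0"
  shows "has_bochner_integral lborel
           (\<lambda>t. indicator {0<..} t * (t ^ k * exp (- (a * t)))) (fact k / a ^ Suc k)"
proof -
  have "(\<lambda>t. indicator {0<..} t * (t powr (real (Suc k) - 1) * exp (- (a * t))))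
      = (\<lambda>t. indicator {0<..} t * (t ^ k * exp (- (a * t))))"
    by (auto simp: fun_eq_iff indicator_def powr_realpow)
  moreover have "Gamma (real (Suc k)) / a powr real (Suc k) = fact k / a ^ Suc k"
    using a Gamma_fact[of k, where 'a = real] by (simp add: powr_realpow add.commute flip: of_nat_Suc power_Suc)
  ultimately show ?thesis
    using has_bochner_integral_powr_exp[of "real (Suc k)" a] a by simp
qed

section \<open>Cosine transforms of powers of 1 / (1 + cosh u)\<close>

text \<open>The exponential decay of the powers of \<open>1 / (1 + cosh u)\<close> justifies Fubini's theorem and
  makes the boundary terms at infinity vanish in the integration by parts.\<close>

lemma inverse_one_plus_cosh_power_le:
  fixes u :: real
  shows "1 / (1 + cosh u) ^ Suc k \<le> 2 * exp (- \<bar>u\<bar>)"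
proof -
  have "exp \<bar>u\<bar> \<le> exp u + exp (- u)"
    by (cases "u < 0") auto
  also have "\<dots> \<le> 2 * (1 + cosh u)"
    by (simp add: cosh_field_def add_divide_distrib)
  also have "1 + cosh u \<le> (1 + cosh u) ^ Suc k"
    using cosh_real_ge_1[of u] by (intro self_le_power) auto
  finally have "exp \<bar>u\<bar> \<le> 2 * (1 + cosh u) ^ Suc k" by simp
  moreover have "(1 + cosh u) ^ Suc k > 0"
    using cosh_real_ge_1[of u] by (intro zero_less_power) linarith
  ultimately show ?thesis
    by (simp add: exp_minus divide_simps mult.commute del: power_Suc)
qed

lemma borel_measurable_cosh [measurable]: "cosh \<in> borel_measurable (borel :: real measure)"
  by (intro borel_measurable_continuous_onI continuous_intros)

lemma integrable_bounded_over_cosh_power: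
  fixes g :: "real \<Rightarrow> real"
  assumes [measurable]: "g \<in> borel_measurable borel" and g: "\<And>u. \<bar>g u\<bar> \<le> 1"
  shows "integrable lborel (\<lambda>u. indicator {0..} u * (g u / (1 + cosh u) ^ Suc k))"
proof (rule Bochner_Integration.integrable_bound)
  have "integrable lborel (\<lambda>u::real. indicator {0<..} u * exp (- u))"
    using has_bochner_integral_power_exp[of 1 0] by (simp add: has_bochner_integral_iff)
  then show "integrable lborel (\<lambda>u::real. 2 * (indicator {0<..} u * exp (- u)))"
    by simp
  have *: "\<bar>g u / (1 + cosh u) ^ Suc k\<bar> \<le> 2 * exp (- u)" if "u > 0" for u
  proof -
    have "\<bar>g u / (1 + cosh u) ^ Suc k\<bar> = \<bar>g u\<bar> * (1 / (1 + cosh u) ^ Suc k)"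
      using cosh_real_ge_1[of u] by (simp add: abs_mult)
    also have "\<dots> \<le> 1 * (2 * exp (- u))"
      using g[of u] inverse_one_plus_cosh_power_le[of u k] cosh_real_ge_1[of u] that
      by (intro mult_mono) auto
    finally show ?thesis by simp
  qed
  have "AE u in lborel. u \<noteq> (0::real)"
    by (rule AE_lborel_singleton)
  then show "AE u in lborel. norm (indicator {0..} u * (g u / (1 + cosh u) ^ Suc k))
      \<le> norm (2 * (indicator {0<..} u * exp (- u)))"
  proof eventually_elim
    case (elim u)
    then show ?case using *[of u] by (auto simp: indicator_def)
  qed
qed simp

definition cosh_cos_transform :: "nat \<Rightarrow> real \<Rightarrow> real" where
  "cosh_cos_transform k \<tau> = (LINT u|lborel. indicator {0..} u * (cos (\<tau> * u) / (1 + cosh u) ^ k))"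

text \<open>Insert the integral representation of \<open>K\<^bsub>i\<tau>\<^esub>\<close> and integrate over \<open>x\<close> first: the factors
  \<open>exp (- x cosh u)\<close> and \<open>exp (- x)\<close> combine to \<open>exp (- (1 + cosh u) x)\<close>, whose moments are
  explicit.  What remains is the cosine transform of a power of \<open>1 / (1 + cosh u)\<close>, and the span
  of these powers is closed under differentiating twice.\<close>

lemma besselK_imag_moment:
  fixes \<tau> :: real
  shows "has_bochner_integral lborel
           (\<lambda>x. indicator {0<..} x * (besselK_imag \<tau> x * (x ^ k * exp (- x))))
           (fact k * cosh_cos_transform (Suc k) \<tau>)"
proof -
  define f :: "real \<Rightarrow> real \<Rightarrow> real" where
    "f u x = (indicator {0..} u * cos (\<tau> * u)) *
             (indicator {0<..} x * (x ^ k * exp (- ((1 + cosh u) * x))))" for u x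
  have inner: "has_bochner_integral lborel (f u)
      ((indicator {0..} u * cos (\<tau> * u)) * (fact k / (1 + cosh u) ^ Suc k))" for u
    unfolding f_def using cosh_real_ge_1[of u]
    by (intro has_bochner_integral_mult_right has_bochner_integral_power_exp) auto
  have [measurable]: "case_prod f \<in> borel_measurable (lborel \<Otimes>\<^sub>M lborel)"
    unfolding f_def by measurable
  have norm_f: "norm (f u x) = \<bar>indicator {0..} u * cos (\<tau> * u)\<bar> *
      (indicator {0<..} x * (x ^ k * exp (- ((1 + cosh u) * x))))" for u x
    by (auto simp: f_def abs_mult indicator_def)
  have norm_inner: "(LINT x|lborel. norm (f u x)) =
      fact k * (indicator {0..} u * (\<bar>cos (\<tau> * u)\<bar> / (1 + cosh u) ^ Suc k))" for u
  proof -
    have "1 + cosh u > 0" using cosh_real_ge_1[of u] by linarith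
    from has_bochner_integral_mult_right[OF has_bochner_integral_power_exp[OF this, of k]] show ?thesis
      unfolding norm_f by (auto simp: has_bochner_integral_iff abs_mult)
  qed
  have int: "integrable (lborel \<Otimes>\<^sub>M lborel) (case_prod f)"
  proof (rule lborel_pair.Fubini_integrable)
    show "integrable lborel (\<lambda>u. LINT x|lborel. norm (case (u, x) of (u, x) \<Rightarrow> f u x))"
      unfolding prod.case norm_inner
      by (intro integrable_mult_right integrable_bounded_over_cosh_power) auto
    show "AE u in lborel. integrable lborel (\<lambda>x. case (u, x) of (u, x) \<Rightarrow> f u x)"
      using inner by (auto simp: has_bochner_integral_iff)
  qed simp
  have K: "(LINT u|lborel. f u x) = indicator {0<..} x * (besselK_imag \<tau> x * (x ^ k * exp (- x)))" for x
  proof -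
    have "f u x = (indicator {0<..} x * (x ^ k * exp (- x))) *
        (indicator {0..} u * (exp (- x * cosh u) * cos (\<tau> * u)))" for u
      unfolding f_def by (simp add: algebra_simps exp_diff exp_minus exp_add field_simps)
    then have "(LINT u|lborel. f u x) = (indicator {0<..} x * (x ^ k * exp (- x))) *
        (LINT u|lborel. indicator {0..} u * (exp (- x * cosh u) * cos (\<tau> * u)))"
      by (simp only: integral_mult_right_zero)
    then show ?thesis
      by (simp add: besselK_imag_def set_lebesgue_integral_def)
  qed
  have "(LINT x|lborel. LINT u|lborel. f u x) = (LINT u|lborel. LINT x|lborel. f u x)"
    by (rule lborel_pair.Fubini_integral[OF int])
  also have "\<dots> = (LINT u|lborel. fact k * (indicator {0..} u * (cos (\<tau> * u) / (1 + cosh u) ^ Suc k)))"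
    using inner by (intro Bochner_Integration.integral_cong) (auto simp: has_bochner_integral_iff)
  also have "\<dots> = fact k * cosh_cos_transform (Suc k) \<tau>"
    unfolding cosh_cos_transform_def by (simp only: integral_mult_right_zero)
  finally show ?thesis
    using lborel_pair.integrable_snd[OF int] by (simp add: K has_bochner_integral_iff)
qed

text \<open>With \<open>m = j + 1\<close>, the function \<open>h u = 1 / (1 + cosh u)\<^sup>m\<close> satisfies
  \<open>h'' u = m\<^sup>2 h u - m (2 m + 1) / (1 + cosh u)\<^sup>m\<^sup>+\<^sup>1\<close>, because
  \<open>(sinh u)\<^sup>2 = (cosh u - 1) (cosh u + 1)\<close>.  Two integrations by parts replace the transform of
  \<open>h''\<close> by \<open>- \<tau>\<^sup>2\<close> times the transform of \<open>h\<close>, since \<open>h'\<close> vanishes at \<open>0\<close> and both \<open>h\<close> and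
  \<open>h'\<close> vanish at infinity.\<close>

lemma cosh_cos_transform_rec:
  "\<tau>\<^sup>2 * cosh_cos_transform (Suc j) \<tau> =
     (2 * real j + 3) * (real j + 1) * cosh_cos_transform (Suc (Suc j)) \<tau>
       - (real j + 1)\<^sup>2 * cosh_cos_transform (Suc j) \<tau>"
proof -
  define m where "m = real (Suc j)"
  \<comment> \<open>Both integrations by parts are done at once: \<open>F = h' cos (\<tau> u) + \<tau> h sin (\<tau> u)\<close> is an
    antiderivative of \<open>G = (h'' + \<tau>\<^sup>2 h) cos (\<tau> u)\<close> and vanishes at both ends.\<close>
  define F where "F u = - m * sinh u / (1 + cosh u) ^ Suc (Suc j) * cos (\<tau> * u)
      + \<tau> * (1 / (1 + cosh u) ^ Suc j) * sin (\<tau> * u)" for u :: real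
  define c where "c k u = cos (\<tau> * u) / (1 + cosh u) ^ k" for k and u :: real
  define G where "G u = (\<tau>\<^sup>2 + m\<^sup>2) * c (Suc j) u - m * (2 * m + 1) * c (Suc (Suc j)) u" for u
  have pos: "1 + cosh u > 0" for u :: real using cosh_real_ge_1[of u] by linarith
  have deriv: "(F has_vector_derivative G u) (at u)" for u
  proof -
    define q where "q = 1 + cosh u"
    have q: "q > 0" "cosh u = q - 1" unfolding q_def using pos by auto
    have s: "sinh u * sinh u = (q - 2) * q"
      using sinh_square_eq[of u] q by (simp add: power2_eq_square algebra_simps)
    have s': "sinh u * (sinh u * x) = (q - 2) * q * x" for x
      using s by (metis mult.assoc)
    have "(F has_field_derivative G u) (at u)"
      unfolding F_def
      apply (rule derivative_eq_intros refl | use pos[of u] in force)+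
      unfolding G_def c_def q_def[symmetric] using q
      apply (simp add: q s s' divide_simps m_def)
      apply (simp add: algebra_simps power2_eq_square s s')
      done
    then show ?thesis by (simp add: has_real_derivative_iff_has_vector_derivative)
  qed
  have int_c: "integrable lborel (\<lambda>u. indicator {0..} u * c (Suc k) u)" for k
    unfolding c_def by (intro integrable_bounded_over_cosh_power) auto
  have int_G: "integrable lborel (\<lambda>u. indicator {0..} u * G u)"
  proof -
    have "integrable lborel (\<lambda>u. (\<tau>\<^sup>2 + m\<^sup>2) * (indicator {0..} u * c (Suc j) u)
        - m * (2 * m + 1) * (indicator {0..} u * c (Suc (Suc j)) u))"
      by (intro Bochner_Integration.integrable_diff integrable_mult_right int_c)
    then show ?thesis by (simp add: G_def algebra_simps)
  qed
  have F_at_top: "(F \<longlongrightarrow> 0) at_top"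
  proof (rule Lim_null_comparison)
    show "((\<lambda>u. (m + \<bar>\<tau>\<bar>) * (2 * exp (- u))) \<longlongrightarrow> 0) at_top"
      by real_asymp
    have F_le: "norm (F u) \<le> (m + \<bar>\<tau>\<bar>) * (2 * exp (- u))" if "u \<ge> 0" for u
    proof -
      define r where "r = 1 / (1 + cosh u) ^ Suc j"
      have r: "0 \<le> r" "r \<le> 2 * exp (- u)"
        using inverse_one_plus_cosh_power_le[of u j] pos[of u] that by (auto simp: r_def)
      have "\<bar>sinh u / (1 + cosh u)\<bar> \<le> 1"
        using sinh_less_cosh_real[of u] pos[of u] that by (simp add: abs_mult)
      then have "\<bar>m * r * (sinh u / (1 + cosh u)) * cos (\<tau> * u)\<bar> \<le> m * r * 1 * 1"
        unfolding abs_mult using r by (intro mult_mono) (auto simp: m_def)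
      moreover have "\<bar>\<tau> * r * sin (\<tau> * u)\<bar> \<le> \<bar>\<tau>\<bar> * r * 1"
        unfolding abs_mult using r by (intro mult_mono) auto
      moreover have "F u = - (m * r * (sinh u / (1 + cosh u)) * cos (\<tau> * u)) + \<tau> * r * sin (\<tau> * u)"
        by (simp add: F_def r_def)
      ultimately have "\<bar>F u\<bar> \<le> m * r + \<bar>\<tau>\<bar> * r"
        by linarith
      also have "\<dots> = (m + \<bar>\<tau>\<bar>) * r"
        by (simp add: algebra_simps)
      also have "\<dots> \<le> (m + \<bar>\<tau>\<bar>) * (2 * exp (- u))"
        using r by (intro mult_left_mono) (auto simp: m_def)
      finally show ?thesis by simp
    qed
    show "\<forall>\<^sub>F u in at_top. norm (F u) \<le> (m + \<bar>\<tau>\<bar>) * (2 * exp (- u))"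
      by (rule eventually_mono[OF eventually_ge_at_top[of 0] F_le])
  qed
  have F0: "(F \<longlongrightarrow> 0) (at_right 0)"
  proof -
    have "isCont F 0"
      using deriv[of 0] has_vector_derivative_continuous by blast
    then show ?thesis
      using filterlim_at_split[of F "nhds (F 0)" 0] by (simp add: F_def isCont_def)
  qed
  have "(LBINT u=0..\<infinity>. G u) = 0 - 0"
  proof (rule interval_integral_FTC_integrable)
    show "isCont G u" for u
      unfolding G_def c_def using pos[of u] by (intro continuous_intros) (auto simp: add_eq_0_iff)
    show "set_integrable lborel (einterval 0 \<infinity>) G"
    proof (rule set_integrable_subset)
      show "set_integrable lborel {0..} G"
        using int_G by (simp add: set_integrable_def)
    qed (auto simp: einterval_def)
  qed (use deriv F_at_top F0 in \<open>auto simp: ereal_tendsto_simps zero_ereal_def\<close>)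
  then have "(LINT u:einterval 0 \<infinity>|lborel. G u) = 0"
    by (simp add: interval_lebesgue_integral_def)
  moreover have "(LINT u:einterval 0 \<infinity>|lborel. G u) = (LINT u|lborel. indicator {0..} u * G u)"
  proof -
    have "AE u in lborel. u \<noteq> (0::real)"
      by (rule AE_lborel_singleton)
    then show ?thesis
      unfolding set_lebesgue_integral_def using int_G
      by (intro integral_cong_AE) (auto simp: indicator_def einterval_def G_def c_def elim!: eventually_mono)
  qed
  moreover have "(LINT u|lborel. indicator {0..} u * G u) =
      (LINT u|lborel. (\<tau>\<^sup>2 + m\<^sup>2) * (indicator {0..} u * c (Suc j) u)
        - m * (2 * m + 1) * (indicator {0..} u * c (Suc (Suc j)) u))"
    by (simp add: G_def algebra_simps)
  moreover have "\<dots> = (\<tau>\<^sup>2 + m\<^sup>2) * cosh_cos_transform (Suc j) \<tau>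
      - m * (2 * m + 1) * cosh_cos_transform (Suc (Suc j)) \<tau>"
    unfolding cosh_cos_transform_def c_def[symmetric] using int_c[of j] int_c[of "Suc j"]
    by (subst Bochner_Integration.integral_diff) auto
  ultimately show ?thesis
    by (simp add: m_def algebra_simps power2_eq_square)
qed

section \<open>Polynomial moments of the Bessel function\<close>

text \<open>The action of \<open>opA\<close> on functions \<open>x * q x * exp (- x)\<close>, as an operator on the polynomial \<open>q\<close>.
  The factor \<open>x\<close> is split off because it cancels the \<open>1 / x\<close> of the measure \<open>dx / x\<close>.\<close>

definition opA_poly :: "real poly \<Rightarrow> real poly" where
  "opA_poly q = [:-1, 3:] * q + [:0, -3, 2:] * pderiv q - [:0, 0, 1:] * pderiv (pderiv q)"

lemma opA_times_poly_exp:
  "opA (\<lambda>x. x * poly q x * exp (- x)) = (\<lambda>x. x * poly (opA_poly q) x * exp (- x))"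
proof -
  define r where "r = [:0, 1:] * q"
  have step: "(\<lambda>y. y * deriv (\<lambda>x. poly p x * exp (- x)) y) =
      (\<lambda>x. poly ([:0, 1:] * (pderiv p - p)) x * exp (- x))" for p :: "real poly"
  proof
    fix y :: real
    have "((\<lambda>x. poly p x * exp (- x)) has_field_derivative (poly (pderiv p - p) y * exp (- y))) (at y)"
      by (rule derivative_eq_intros refl | simp add: algebra_simps)+
    then show "y * deriv (\<lambda>x. poly p x * exp (- x)) y = poly ([:0, 1:] * (pderiv p - p)) y * exp (- y)"
      by (simp add: DERIV_imp_deriv)
  qed
  have 1: "(\<lambda>x. x * poly q x * exp (- x)) = (\<lambda>x. poly r x * exp (- x))"
    by (simp add: r_def)
  have "opA (\<lambda>x. poly r x * exp (- x)) =
      (\<lambda>x. x\<^sup>2 * (poly r x * exp (- x))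
         - poly ([:0, 1:] * (pderiv ([:0, 1:] * (pderiv r - r)) - [:0, 1:] * (pderiv r - r))) x * exp (- x))"
    unfolding opA_def step step[THEN fun_cong] ..
  then show ?thesis
    unfolding 1 by (simp add: fun_eq_iff r_def opA_poly_def pderiv_mult pderiv_diff pderiv_add pderiv_pCons
      algebra_simps power2_eq_square)
qed

text \<open>One application of \<open>opA\<close> turns \<open>exp (- x)\<close> into \<open>x * exp (- x)\<close>; this is where the factor \<open>x\<close>
  appears, and from then on it persists.\<close>

lemma opA_power_exp:
  "(opA ^^ Suc n) (\<lambda>x. exp (- x)) = (\<lambda>x. x * poly ((opA_poly ^^ n) 1) x * exp (- x))"
proof (induction n)
  case 0
  have 1: "((\<lambda>x::real. exp (- x)) has_field_derivative - exp (- x)) (at x)" for x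
    by (rule derivative_eq_intros refl | simp)+
  have 2: "((\<lambda>x::real. - (x * exp (- x))) has_field_derivative (x * exp (- x) - exp (- x))) (at x)" for x
    by (rule derivative_eq_intros refl | simp)+
  show ?case
    using 1[THEN DERIV_imp_deriv] 2[THEN DERIV_imp_deriv]
    by (simp add: opA_def fun_eq_iff right_diff_distrib power2_eq_square)
next
  case (Suc n)
  then show ?case
    by (simp add: opA_times_poly_exp)
qed

lemma polyp_Suc:
  "polyp (Suc n) x = (-1) ^ Suc n * (x * poly ((opA_poly ^^ n) 1) x)"
  unfolding polyp_def opA_power_exp by (simp add: exp_minus)

text \<open>The value of the integral of \<open>K\<^bsub>i\<tau>\<^esub>(x) q x exp (- x)\<close> over \<open>x > 0\<close>, written out over the
  coefficients of \<open>q\<close>.\<close>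

definition besselK_poly_moment :: "real \<Rightarrow> real poly \<Rightarrow> real" where
  "besselK_poly_moment \<tau> q = (\<Sum>k\<le>degree q. coeff q k * (fact k * cosh_cos_transform (Suc k) \<tau>))"

lemma has_bochner_integral_besselK_poly:
  "has_bochner_integral lborel
     (\<lambda>x. indicator {0<..} x * (besselK_imag \<tau> x * (poly q x * exp (- x)))) (besselK_poly_moment \<tau> q)"
proof -
  have "has_bochner_integral lborel
     (\<lambda>x. \<Sum>k\<le>degree q. coeff q k * (indicator {0<..} x * (besselK_imag \<tau> x * (x ^ k * exp (- x)))))
     (besselK_poly_moment \<tau> q)"
    unfolding besselK_poly_moment_def
    by (intro has_bochner_integral_sum has_bochner_integral_mult_right besselK_imag_moment)
  then show ?thesis
    by (simp add: poly_altdef sum_distrib_left sum_distrib_right mult_ac)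
qed

lemma besselK_poly_moment_unique:
  "has_bochner_integral lborel
     (\<lambda>x. indicator {0<..} x * (besselK_imag \<tau> x * (poly q x * exp (- x)))) c \<Longrightarrow>
   besselK_poly_moment \<tau> q = c"
  using has_bochner_integral_besselK_poly has_bochner_integral_eq by blast

lemma besselK_poly_moment_add:
  "besselK_poly_moment \<tau> (p + q) = besselK_poly_moment \<tau> p + besselK_poly_moment \<tau> q"
  using has_bochner_integral_add[OF has_bochner_integral_besselK_poly[of \<tau> p]
      has_bochner_integral_besselK_poly[of \<tau> q]]
  by (intro besselK_poly_moment_unique) (simp add: algebra_simps)

lemma besselK_poly_moment_smult:
  "besselK_poly_moment \<tau> (smult c q) = c * besselK_poly_moment \<tau> q"
  using has_bochner_integral_mult_right[of c, OF has_bochner_integral_besselK_poly[of \<tau> q]]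
  by (intro besselK_poly_moment_unique) (simp add: algebra_simps)

lemma besselK_poly_moment_monom:
  "besselK_poly_moment \<tau> (monom 1 k) = fact k * cosh_cos_transform (Suc k) \<tau>"
  using besselK_imag_moment[of \<tau> k]
  by (intro besselK_poly_moment_unique) (simp add: poly_monom)

lemma opA_poly_add: "opA_poly (p + q) = opA_poly p + opA_poly q"
  by (rule poly_ext) (simp add: opA_poly_def pderiv_add algebra_simps)

lemma opA_poly_smult: "opA_poly (smult c q) = smult c (opA_poly q)"
  by (simp add: opA_poly_def pderiv_smult smult_add_right smult_diff_right)

lemma opA_poly_monom:
  "opA_poly (monom 1 k) = smult (2 * real k + 3) (monom 1 (Suc k)) + smult (- ((real k + 1)\<^sup>2)) (monom 1 k)"
proof (rule poly_ext)
  fix x :: real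
  show "poly (opA_poly (monom 1 k)) x = 
    poly (smult (2 * real k + 3) (monom 1 (Suc k)) + smult (- ((real k + 1)\<^sup>2)) (monom 1 k)) x"
    by (cases k; cases "k - 1")
       (simp_all add: opA_poly_def pderiv_monom poly_monom algebra_simps power2_eq_square)
qed

text \<open>This expresses that \<open>opA\<close> is symmetric with respect to \<open>dx / x\<close> and has \<open>K\<^bsub>i\<tau>\<^esub>\<close> as an eigenfunction
  with eigenvalue \<open>\<tau>\<^sup>2\<close>.  On monomials it is the recurrence for the cosine transforms, so no
  derivative of \<open>K\<^bsub>i\<tau>\<^esub>\<close> is involved.\<close>

lemma besselK_poly_moment_opA_poly:
  "besselK_poly_moment \<tau> (opA_poly q) = \<tau>\<^sup>2 * besselK_poly_moment \<tau> q"
proof -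
  have monom: "besselK_poly_moment \<tau> (opA_poly (monom 1 k)) = \<tau>\<^sup>2 * besselK_poly_moment \<tau> (monom 1 k)" for k
    using arg_cong[OF cosh_cos_transform_rec[of \<tau> k], of "\<lambda>x. fact k * x"]
    unfolding opA_poly_monom besselK_poly_moment_add besselK_poly_moment_smult besselK_poly_moment_monom
    by (simp add: algebra_simps)
  have "besselK_poly_moment \<tau> (opA_poly (\<Sum>k<n. smult (a k) (monom 1 k))) =
      \<tau>\<^sup>2 * besselK_poly_moment \<tau> (\<Sum>k<n. smult (a k) (monom 1 k))" for n and a :: "nat \<Rightarrow> real"
  proof (induction n)
    case 0
    show ?case by (simp add: opA_poly_def besselK_poly_moment_def)
  next
    case (Suc n)
    then show ?case
      unfolding sum.lessThan_Suc opA_poly_add opA_poly_smult besselK_poly_moment_add besselK_poly_moment_smult monom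
      by (simp add: algebra_simps)
  qed
  from this[of "coeff q" "Suc (degree q)"] show ?thesis
    by (simp add: smult_monom poly_as_sum_of_monoms lessThan_Suc_atMost del: sum.lessThan_Suc)
qed

lemma besselK_poly_moment_opA_poly_power:
  "besselK_poly_moment \<tau> ((opA_poly ^^ n) 1) = \<tau> ^ (2 * n) * cosh_cos_transform 1 \<tau>"
proof (induction n)
  case 0
  show ?case
    using besselK_poly_moment_monom[of \<tau> 0] by simp
next
  case (Suc n)
  then show ?case
    by (simp add: besselK_poly_moment_opA_poly power2_eq_square)
qed

section \<open>Evaluation of the first cosine transform\<close>

text \<open>This is Euler's integral after the substitution \<open>t = y exp u\<close>.  The scale \<open>y\<close> is left free
  because it becomes the integration variable of a second Gamma integral.\<close>

lemma Gamma_integral_exp_substitution: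
  assumes z: "Re z > 0" and y: "y > 0"
  shows "has_bochner_integral lborel
           (\<lambda>u. complex_of_real y powr z * exp (z * of_real u) * of_real (exp (- (y * exp u)))) (Gamma z)"
proof -
  define f where "f t = complex_of_real t powr (z - 1) / of_real (exp t)" for t
  have range: "(\<lambda>u. y * exp u) ` UNIV = {0<..}"
  proof safe
    fix t :: real assume "t > 0"
    then have "t = y * exp (ln (t / y))" using y by simp
    then show "t \<in> range (\<lambda>u. y * exp u)" by blast
  qed (use y in auto)
  have "f absolutely_integrable_on {0<..}" "integral {0<..} f = Gamma z"
    using absolutely_integrable_Gamma_integral'[OF z] integral_unique[OF Gamma_integral_complex'[OF z]]
    unfolding f_def by auto
  moreover have "((\<lambda>u. y * exp u) has_field_derivative y * exp u) (at u)" for u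
    by (rule derivative_eq_intros refl | simp)+
  ultimately have *: "(\<lambda>u. \<bar>y * exp u\<bar> *\<^sub>R f (y * exp u)) absolutely_integrable_on UNIV"
    "integral UNIV (\<lambda>u. \<bar>y * exp u\<bar> *\<^sub>R f (y * exp u)) = Gamma z"
    using has_absolute_integral_change_of_variables_real[of UNIV "\<lambda>u. y * exp u" "\<lambda>u. y * exp u" f "Gamma z"] y
    unfolding range by (auto simp: inj_on_def)
  have eq: "(\<lambda>u. \<bar>y * exp u\<bar> *\<^sub>R f (y * exp u)) =
      (\<lambda>u. complex_of_real y powr z * exp (z * of_real u) * of_real (exp (- (y * exp u))))"
  proof
    fix u
    have "ln (y * exp u) = ln y + u" using y by (simp add: ln_mult)
    then have "\<bar>y * exp u\<bar> *\<^sub>R f (y * exp u) =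
        of_real (exp (ln y + u)) * exp ((z - 1) * of_real (ln y + u)) * of_real (exp (- (y * exp u)))"
      using y by (simp add: f_def powr_def Ln_of_real scaleR_conv_of_real exp_add exp_minus divide_inverse
        del: of_real_mult)
    also have "of_real (exp (ln y + u)) * exp ((z - 1) * of_real (ln y + u)) =
        exp (z * of_real (ln y)) * exp (z * of_real u)"
      unfolding exp_of_real[symmetric] exp_add[symmetric] by (simp add: algebra_simps)
    also have "exp (z * of_real (ln y)) = complex_of_real y powr z"
      using y by (simp add: powr_def Ln_of_real)
    finally show "\<bar>y * exp u\<bar> *\<^sub>R f (y * exp u) =
        complex_of_real y powr z * exp (z * of_real u) * of_real (exp (- (y * exp u)))" .
  qed
  let ?g = "\<lambda>u. complex_of_real y powr z * exp (z * of_real u) * of_real (exp (- (y * exp u)))"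
  have [measurable]: "?g \<in> borel_measurable lborel"
    by measurable
  have int: "integrable lborel ?g"
    using *(1) unfolding eq set_integrable_def by (simp add: integrable_completion)
  then show ?thesis
    using *(2) integral_lborel[OF int] unfolding eq by (simp add: has_bochner_integral_iff)
qed

lemma has_bochner_integral_Gamma_complex:
  assumes z: "Re z > 0"
  shows "has_bochner_integral lborel
           (\<lambda>t. indicator {0<..} t *\<^sub>R (complex_of_real t powr (z - 1) * of_real (exp (- t)))) (Gamma z)"
proof -
  let ?g = "\<lambda>t. indicator {0<..} t *\<^sub>R (complex_of_real t powr (z - 1) * of_real (exp (- t)))"
  have eq: "(\<lambda>t. indicator {0<..} t *\<^sub>R (complex_of_real t powr (z - 1) / of_real (exp t))) = ?g"
    by (simp add: fun_eq_iff exp_minus divide_inverse)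
  have "?g = (\<lambda>t. indicator {0<..} t *\<^sub>R (exp ((z - 1) * of_real (ln t)) * of_real (exp (- t))))"
    by (auto simp: fun_eq_iff indicator_def powr_def Ln_of_real)
  also have "\<dots> \<in> borel_measurable lborel"
    by measurable
  finally have [measurable]: "?g \<in> borel_measurable lborel" .
  have "set_integrable lebesgue {0<..} (\<lambda>t. complex_of_real t powr (z - 1) / of_real (exp t))"
    by (rule absolutely_integrable_Gamma_integral'[OF z])
  then have int: "integrable lborel ?g"
    unfolding set_integrable_def eq by (simp add: integrable_completion)
  have "(?g has_integral Gamma z) UNIV"
    using Gamma_integral_complex'[OF z]
    unfolding has_integral_restrict_UNIV[of "{0<..}", symmetric] eq[symmetric]
    by (rule has_integral_eq[rotated]) (auto simp: indicator_def)
  then show ?thesis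
    using int integral_lborel[OF int] by (simp add: has_bochner_integral_iff integral_unique)
qed

lemma exp_over_one_plus_exp_square:
  "exp u / (1 + exp u)\<^sup>2 = 1 / (2 * (1 + cosh u))" for u :: real
proof -
  have "exp u * (2 * (1 + cosh u)) = (1 + exp u)\<^sup>2"
    by (simp add: cosh_field_def exp_minus power2_eq_square field_simps)
  moreover have "1 + cosh u > 0" using cosh_real_ge_1[of u] by linarith
  moreover have "1 + exp u > 0" by (simp add: add_pos_pos)
  ultimately show ?thesis
    by (simp add: divide_simps)
qed

lemma Gamma_reflection_imag:
  assumes "\<tau> > 0"
  shows "Gamma (1 + \<i> * of_real \<tau>) * Gamma (1 - \<i> * of_real \<tau>) = of_real (pi * \<tau> / sinh (pi * \<tau>))"
proof -
  define z where "z = \<i> * complex_of_real \<tau>"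
  have "z \<notin> \<int>"
    using assms by (auto simp: z_def complex_is_Int_iff)
  then have "Gamma (1 + z) = z * Gamma z"
    using Gamma_plus1[of z] nonpos_Ints_Int by (metis add.commute)
  then have "Gamma (1 + z) * Gamma (1 - z) = z * (of_real pi / sin (of_real pi * z))"
    using Gamma_reflection_complex[of z] by (simp add: mult.assoc)
  also have "sin (of_real pi * z) = \<i> * of_real (sinh (pi * \<tau>))"
    unfolding z_def by (simp add: complex_eq_iff Re_sin Im_sin sinh_field_def exp_minus field_simps power2_eq_square)
  finally show ?thesis
    by (simp add: z_def field_simps)
qed

text \<open>The product \<open>\<Gamma>(1 + i \<tau>) \<Gamma>(1 - i \<tau>)\<close> is a double integral over \<open>u\<close> and \<open>y\<close> with integrand
  \<open>exp (i \<tau> u) exp u y exp (- (1 + exp u) y)\<close>.  Integrating over \<open>y\<close> first leaves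
  \<open>exp (i \<tau> u) exp u / (1 + exp u)\<^sup>2 = exp (i \<tau> u) / (2 (1 + cosh u))\<close>, whose integral over the whole
  line is the cosine transform; integrating over \<open>u\<close> first splits off one Gamma integral after the
  other.  The reflection formula gives the closed form.\<close>

lemma cosh_cos_transform_1:
  assumes \<tau>: "\<tau> > 0"
  shows "cosh_cos_transform 1 \<tau> = pi * \<tau> / sinh (pi * \<tau>)"
proof -
  define z where "z = 1 + \<i> * complex_of_real \<tau>"
  define w where "w = 1 - \<i> * complex_of_real \<tau>"
  define g :: "real \<Rightarrow> real \<Rightarrow> complex" where
    "g u y = exp (\<i> * of_real (\<tau> * u)) *
       of_real (exp u * (indicator {0<..} y * (y ^ 1 * exp (- ((1 + exp u) * y)))))" for u y
  have int_y: "has_bochner_integral lborel (\<lambda>y. indicator {0<..} y * (y ^ 1 * exp (- ((1 + exp u) * y))))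
      (1 / (1 + exp u)\<^sup>2)" for u :: real
    using has_bochner_integral_power_exp[of "1 + exp u" 1] by (simp add: add_pos_pos power2_eq_square)
  have inner: "has_bochner_integral lborel (g u)
      (exp (\<i> * of_real (\<tau> * u)) * of_real (exp u * (1 / (1 + exp u)\<^sup>2)))" for u
    unfolding g_def
    by (intro has_bochner_integral_mult_right has_bochner_integral_of_real int_y)
  have [measurable]: "case_prod g \<in> borel_measurable (lborel \<Otimes>\<^sub>M lborel)"
    unfolding g_def by measurable
  have norm_g: "norm (g u y) = exp u * (indicator {0<..} y * (y ^ 1 * exp (- ((1 + exp u) * y))))" for u y
    by (simp add: g_def norm_mult indicator_def del: of_real_mult)
  have norm_inner: "(LINT y|lborel. norm (g u y)) = 1 / (2 * (1 + cosh u))" for u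
    using has_bochner_integral_mult_right[OF int_y[of u], of "exp u"]
    unfolding norm_g by (simp add: has_bochner_integral_iff exp_over_one_plus_exp_square)
  have even_int: "has_bochner_integral lborel (\<lambda>u. c u / (2 * (1 + cosh u)))
      (LINT u|lborel. indicator {0..} u * (c u / (1 + cosh u) ^ 1))"
    if "c \<in> borel_measurable borel" "\<And>u. \<bar>c u\<bar> \<le> 1" "\<And>u. c (- u) = c u" for c :: "real \<Rightarrow> real"
  proof -
    have "has_bochner_integral lborel (\<lambda>u. indicator {0..} u *\<^sub>R (c u / (1 + cosh u) ^ 1))
        (LINT u|lborel. indicator {0..} u * (c u / (1 + cosh u) ^ 1))"
      using integrable_bounded_over_cosh_power[of c 0, OF that(1,2)] by (simp add: has_bochner_integral_iff)
    from has_bochner_integral_mult_right[OF has_bochner_integral_even_function[OF this], of "1 / 2"] that(3)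
    show ?thesis by (simp add: field_simps)
  qed
  have int: "integrable (lborel \<Otimes>\<^sub>M lborel) (case_prod g)"
  proof (rule lborel_pair.Fubini_integrable)
    show "integrable lborel (\<lambda>u. LINT y|lborel. norm (case (u, y) of (u, y) \<Rightarrow> g u y))"
      unfolding prod.case norm_inner
      using even_int[of "\<lambda>_. 1"] by (simp add: has_bochner_integral_iff)
    show "AE u in lborel. integrable lborel (\<lambda>y. case (u, y) of (u, y) \<Rightarrow> g u y)"
      using inner by (auto simp: has_bochner_integral_iff)
  qed simp
  have inner': "(LINT u|lborel. g u y) =
      Gamma z * (indicator {0<..} y *\<^sub>R (complex_of_real y powr (w - 1) * of_real (exp (- y))))" for y
  proof (cases "y > 0")
    case True
    have "complex_of_real y powr z * complex_of_real y powr (w - 1) = complex_of_real y powr 1"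
      unfolding powr_add[symmetric] z_def w_def by simp
    then have y: "complex_of_real y powr z * complex_of_real y powr (w - 1) = of_real y"
      using True by simp
    have "g u y = complex_of_real y powr z * exp (z * of_real u) * of_real (exp (- (y * exp u))) *
        (complex_of_real y powr (w - 1) * of_real (exp (- y)))" for u
    proof -
      have "g u y = of_real y * (exp (\<i> * of_real (\<tau> * u)) * exp (of_real u)) *
          (of_real (exp (- (y * exp u)) * exp (- y)))"
        using True by (simp add: g_def ring_distribs exp_diff exp_minus field_simps flip: exp_of_real)
      also have "exp (\<i> * of_real (\<tau> * u)) * exp (of_real u) = exp (z * of_real u)"
        by (simp add: z_def ring_distribs exp_add mult_ac)
      also have "of_real y * exp (z * of_real u) * (of_real (exp (- (y * exp u)) * exp (- y))) =
          (complex_of_real y powr z * complex_of_real y powr (w - 1)) * exp (z * of_real u) *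
          (of_real (exp (- (y * exp u))) * of_real (exp (- y)))"
        by (simp only: y of_real_mult)
      finally show ?thesis
        by (simp only: mult_ac)
    qed
    then have "has_bochner_integral lborel (\<lambda>u. g u y)
        (Gamma z * (complex_of_real y powr (w - 1) * of_real (exp (- y))))"
      using has_bochner_integral_mult_left[OF Gamma_integral_exp_substitution[of z y]] True
      by (simp add: z_def)
    then show ?thesis using True by (simp add: has_bochner_integral_iff)
  qed (simp add: g_def)
  have Re_inner: "Re (LINT y|lborel. g u y) = cos (\<tau> * u) / (2 * (1 + cosh u))" for u
    using inner[of u] exp_over_one_plus_exp_square[of u]
    by (simp add: has_bochner_integral_iff Re_exp flip: of_real_mult)
  have "Gamma z * Gamma w = (LINT y|lborel. LINT u|lborel. g u y)"
    unfolding inner' using has_bochner_integral_mult_right[OF has_bochner_integral_Gamma_complex[of w], of "Gamma z"]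
    by (simp add: has_bochner_integral_iff w_def)
  also have "\<dots> = (LINT u|lborel. LINT y|lborel. g u y)"
    by (rule lborel_pair.Fubini_integral[OF int])
  also have "Re \<dots> = (LINT u|lborel. Re (LINT y|lborel. g u y))"
    using lborel_pair.integrable_fst[OF int] by simp
  also have "\<dots> = (LINT u|lborel. cos (\<tau> * u) / (2 * (1 + cosh u)))"
    unfolding Re_inner ..
  also have "\<dots> = cosh_cos_transform 1 \<tau>"
    using even_int[of "\<lambda>u. cos (\<tau> * u)"] by (simp add: has_bochner_integral_iff cosh_cos_transform_def)
  finally show ?thesis
    using Gamma_reflection_imag[OF \<tau>] by (simp add: z_def w_def)
qed

section \<open>The integral over the order\<close>

lemma sums_odd_riemann_zeta:
  assumes "\<alpha> > 1"
  shows "(\<lambda>m. 1 / real (2 * m + 1) powr \<alpha>) sums ((1 - 1 / 2 powr \<alpha>) * riemann_zeta \<alpha>)"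
proof -
  define a where "a n = 1 / real (Suc n) powr \<alpha>" for n
  have "summable (\<lambda>n. real n powr (- \<alpha>))"
    using assms by (subst summable_real_powr_iff) simp
  then have "summable a"
    unfolding a_def by (subst (asm) summable_Suc_iff[symmetric]) (simp add: powr_minus divide_inverse)
  then have a: "a sums riemann_zeta \<alpha>"
    unfolding riemann_zeta_def a_def by (rule summable_sums)
  then have "(\<lambda>n. a (2 * n) + a (2 * n + 1)) sums riemann_zeta \<alpha>"
    using sums_group[of a _ 2] by (simp add: mult.commute)
  moreover have "a (2 * n + 1) = 1 / 2 powr \<alpha> * a n" for n
    by (simp add: a_def powr_mult[symmetric] algebra_simps)
  ultimately have "(\<lambda>n. a (2 * n) + 1 / 2 powr \<alpha> * a n - 1 / 2 powr \<alpha> * a n)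
      sums (riemann_zeta \<alpha> - 1 / 2 powr \<alpha> * riemann_zeta \<alpha>)"
    by (intro sums_diff sums_mult a) simp
  then show ?thesis
    by (simp add: a_def algebra_simps)
qed

text \<open>Expand \<open>\<pi> / sinh (\<pi> t) = 2 \<pi> (\<Sum>m. exp (- (2 m + 1) \<pi> t))\<close>
  for \<open>t > 0\<close> and integrate term by term; all terms are
  nonnegative.  The result is a Dirichlet series over the odd integers.\<close>

lemma has_bochner_integral_powr_over_sinh:
  assumes \<alpha>: "\<alpha> > 1"
  shows "has_bochner_integral lborel (\<lambda>t. indicator {0<..} t * (t powr (\<alpha> - 1) * (pi / sinh (pi * t))))
           ((2 powr \<alpha> - 1) / (2 * pi) powr (\<alpha> - 1) * Gamma \<alpha> * riemann_zeta \<alpha>)"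
proof -
  define f :: "nat \<Rightarrow> real \<Rightarrow> real" where
    "f m t = 2 * pi * (indicator {0<..} t * (t powr (\<alpha> - 1) * exp (- ((2 * real m + 1) * pi * t))))" for m t
  have int: "has_bochner_integral lborel (f m) (2 * pi * (Gamma \<alpha> / ((2 * real m + 1) * pi) powr \<alpha>))" for m
    unfolding f_def using \<alpha>
    by (intro has_bochner_integral_mult_right has_bochner_integral_powr_exp) (auto simp: add_nonneg_pos)
  have f_nonneg: "f m t \<ge> 0" for m t
    by (simp add: f_def)
  define S where "S = 2 * pi powr (1 - \<alpha>) * Gamma \<alpha> * ((1 - 1 / 2 powr \<alpha>) * riemann_zeta \<alpha>)"
  have "(\<lambda>m. 2 * pi powr (1 - \<alpha>) * Gamma \<alpha> * (1 / real (2 * m + 1) powr \<alpha>)) sums S"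
    unfolding S_def by (intro sums_mult sums_odd_riemann_zeta \<alpha>)
  also have "(\<lambda>m. 2 * pi powr (1 - \<alpha>) * Gamma \<alpha> * (1 / real (2 * m + 1) powr \<alpha>)) =
      (\<lambda>m. integral\<^sup>L lborel (f m))"
    using int by (auto simp: fun_eq_iff has_bochner_integral_iff powr_mult powr_diff add.commute)
  finally have sums_S: "(\<lambda>m. integral\<^sup>L lborel (f m)) sums S" .
  have sums_f: "(\<lambda>m. f m t) sums (indicator {0<..} t * (t powr (\<alpha> - 1) * (pi / sinh (pi * t))))" for t
  proof (cases "t > 0")
    case True
    define q where "q = exp (- (pi * t))"
    have q: "0 < q" "q < 1" using True by (auto simp: q_def)
    have "(\<lambda>m. (2 * pi * t powr (\<alpha> - 1) * q) * (q\<^sup>2) ^ m) sums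
        ((2 * pi * t powr (\<alpha> - 1) * q) * (1 / (1 - q\<^sup>2)))"
      using q by (intro sums_mult geometric_sums) (simp add: power_less_one_iff abs_square_less_1)
    moreover have "(2 * pi * t powr (\<alpha> - 1) * q) * (q\<^sup>2) ^ m = f m t" for m
    proof -
      have "q * (q\<^sup>2) ^ m = exp (- ((2 * real m + 1) * pi * t))"
        unfolding q_def by (simp add: algebra_simps flip: exp_of_nat_mult exp_add)
      then show ?thesis using True by (simp add: f_def mult_ac)
    qed
    moreover have "2 * q * (1 / (1 - q\<^sup>2)) = 1 / sinh (pi * t)"
    proof -
      have "sinh (pi * t) = (1 / q - q) / 2"
        by (simp add: sinh_field_def q_def exp_minus field_simps)
      moreover have "1 - q\<^sup>2 > 0" using q by (simp add: power_less_one_iff)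
      ultimately show ?thesis
        using q True by (simp add: divide_simps power2_eq_square mult_ac)
    qed
    moreover have "(2 * pi * t powr (\<alpha> - 1) * q) * (1 / (1 - q\<^sup>2)) =
        t powr (\<alpha> - 1) * (pi * (2 * q * (1 / (1 - q\<^sup>2))))"
      by simp
    ultimately show ?thesis using True by simp
  qed (simp add: f_def)
  have 1: "integrable lborel (f m)" for m
    using int by (simp add: has_bochner_integral_iff)
  have 2: "AE t in lborel. summable (\<lambda>m. norm (f m t))"
    using sums_f f_nonneg by (auto simp: sums_iff)
  have 3: "summable (\<lambda>m. LINT t|lborel. norm (f m t))"
    using sums_S f_nonneg by (simp add: sums_iff)
  have "has_bochner_integral lborel (\<lambda>t. indicator {0<..} t * (t powr (\<alpha> - 1) * (pi / sinh (pi * t)))) S"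
    using integrable_suminf[OF 1 2 3] integral_suminf[OF 1 2 3] sums_f sums_S
    by (simp add: has_bochner_integral_iff sums_iff)
  moreover have "S = (2 powr \<alpha> - 1) / (2 * pi) powr (\<alpha> - 1) * Gamma \<alpha> * riemann_zeta \<alpha>"
    by (simp add: S_def powr_mult powr_diff field_simps)
  ultimately show ?thesis by simp
qed

text \<open>Both parities of \<open>\<lfloor>\<alpha>\<rfloor>\<close> are instances: all that matters is that the exponent \<open>e\<close> of \<open>\<tau>\<close> and the
  index \<open>n\<close> satisfy \<open>e + 2 n = \<alpha>\<close>.  Then the inner integral, together with \<open>\<tau> powr e\<close>, is
  \<open>(-1)\<^sup>n \<tau> powr (\<alpha> - 1) \<pi> / sinh (\<pi> \<tau>)\<close>.\<close>

lemma besselK_polyp_iterated_integral: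
  fixes \<alpha> e :: real
  assumes \<alpha>: "\<alpha> > 1" and n: "n > 0" and e: "e + 2 * real n = \<alpha>"
  defines "F \<equiv> \<lambda>\<tau> x. \<tau> powr e * besselK_imag \<tau> x * exp (- x) * polyp n x / x"
  shows "iterated_integrable F \<and>
    (2 powr \<alpha> - 1) / (2 * pi) powr (\<alpha> - 1) * Gamma \<alpha> * riemann_zeta \<alpha> = (-1) ^ n * iterated_integral F"
proof -
  obtain k where k: "n = Suc k" using n by (cases n) auto
  define R where "R = (2 powr \<alpha> - 1) / (2 * pi) powr (\<alpha> - 1) * Gamma \<alpha> * riemann_zeta \<alpha>"
  have inner: "has_bochner_integral lborel (\<lambda>x. indicator {0<..} x * F \<tau> x)
      ((-1) ^ n * (\<tau> powr (\<alpha> - 1) * (pi / sinh (pi * \<tau>))))" if "\<tau> > 0" for \<tau>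
  proof -
    have "has_bochner_integral lborel
        (\<lambda>x. (-1) ^ n * \<tau> powr e * (indicator {0<..} x * (besselK_imag \<tau> x * (poly ((opA_poly ^^ k) 1) x * exp (- x)))))
        ((-1) ^ n * \<tau> powr e * besselK_poly_moment \<tau> ((opA_poly ^^ k) 1))"
      by (intro has_bochner_integral_mult_right has_bochner_integral_besselK_poly)
    also have "(\<lambda>x. (-1) ^ n * \<tau> powr e * (indicator {0<..} x * (besselK_imag \<tau> x * (poly ((opA_poly ^^ k) 1) x * exp (- x)))))
        = (\<lambda>x. indicator {0<..} x * F \<tau> x)"
      by (auto simp: fun_eq_iff indicator_def F_def k polyp_Suc)
    also have "besselK_poly_moment \<tau> ((opA_poly ^^ k) 1) = \<tau> powr (2 * real k) * (pi * \<tau> / sinh (pi * \<tau>))"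
      using that powr_realpow[of \<tau> "2 * k"]
      by (simp add: besselK_poly_moment_opA_poly_power cosh_cos_transform_1 del: One_nat_def)
    also have "(-1) ^ n * \<tau> powr e * (\<tau> powr (2 * real k) * (pi * \<tau> / sinh (pi * \<tau>))) =
        (-1) ^ n * ((\<tau> powr e * \<tau> powr (2 * real k) * \<tau> powr 1) * (pi / sinh (pi * \<tau>)))"
      using that by simp
    also have "\<tau> powr e * \<tau> powr (2 * real k) * \<tau> powr 1 = \<tau> powr (\<alpha> - 1)"
    proof -
      have "e + 2 * real k + 1 = \<alpha> - 1" using e k by simp
      then show ?thesis by (simp only: powr_add[symmetric])
    qed
    finally show ?thesis .
  qed
  have "has_bochner_integral lborel
      (\<lambda>\<tau>. (-1) ^ n * (indicator {0<..} \<tau> * (\<tau> powr (\<alpha> - 1) * (pi / sinh (pi * \<tau>))))) ((-1) ^ n * R)"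
    unfolding R_def by (intro has_bochner_integral_mult_right has_bochner_integral_powr_over_sinh \<alpha>)
  also have "(\<lambda>\<tau>. (-1) ^ n * (indicator {0<..} \<tau> * (\<tau> powr (\<alpha> - 1) * (pi / sinh (pi * \<tau>))))) =
      (\<lambda>\<tau>. indicator {0<..} \<tau> *\<^sub>R (LINT x:{0<..}|lborel. F \<tau> x))"
    using inner by (auto simp: fun_eq_iff indicator_def[of "{0<..}" "_::real"]
        set_lebesgue_integral_def has_bochner_integral_iff)
  finally have "has_bochner_integral lborel
      (\<lambda>\<tau>. indicator {0<..} \<tau> *\<^sub>R (LINT x:{0<..}|lborel. F \<tau> x)) ((-1) ^ n * R)" .
  then have "set_integrable lborel {0<..} (\<lambda>\<tau>. LINT x:{0<..}|lborel. F \<tau> x)"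
    and "iterated_integral F = (-1) ^ n * R"
    by (auto simp: has_bochner_integral_iff set_integrable_def iterated_integral_def
        set_lebesgue_integral_def[of lborel _ "\<lambda>\<tau>. LINT x:{0<..}|lborel. F \<tau> x"])
  moreover have "set_integrable lborel {0<..} (F \<tau>)" if "\<tau> > 0" for \<tau>
    using inner[OF that] by (simp add: has_bochner_integral_iff set_integrable_def)
  moreover have "(-1) ^ n * ((-1) ^ n * R) = R"
    by (simp flip: mult.assoc power_mult_distrib)
  ultimately show ?thesis
    by (simp add: iterated_integrable_def R_def)
qed

theorem theorem5:
  fixes \<alpha> :: real
  assumes "\<alpha> > 1"
  shows "(even \<lfloor>\<alpha>\<rfloor> \<longrightarrow>
      (let n = nat (\<lfloor>\<alpha>\<rfloor> div 2);
           F = (\<lambda>\<tau> x. \<tau> powr frac \<alpha> * besselK_imag \<tau> x * exp (- x) * polyp n x / x)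
       in iterated_integrable F \<and>
          (2 powr \<alpha> - 1) / (2 * pi) powr (\<alpha> - 1) * Gamma \<alpha> * riemann_zeta \<alpha>
            = (-1) ^ nat (\<lfloor>\<alpha>\<rfloor> div 2) * iterated_integral F)) \<and>
    (odd \<lfloor>\<alpha>\<rfloor> \<longrightarrow>
      (let n = nat ((\<lfloor>\<alpha>\<rfloor> + 1) div 2);
           F = (\<lambda>\<tau> x. \<tau> powr (frac \<alpha> - 1) * besselK_imag \<tau> x * exp (- x) * polyp n x / x)
       in iterated_integrable F \<and>
          (2 powr \<alpha> - 1) / (2 * pi) powr (\<alpha> - 1) * Gamma \<alpha> * riemann_zeta \<alpha>
            = (-1) ^ nat ((\<lfloor>\<alpha>\<rfloor> + 1) div 2) * iterated_integral F))"
proof (intro conjI impI)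
  have floor: "\<lfloor>\<alpha>\<rfloor> \<ge> 1" using assms by simp
  {
    assume "even \<lfloor>\<alpha>\<rfloor>"
    then obtain m where m: "\<lfloor>\<alpha>\<rfloor> = 2 * m" by blast
    then have "nat (\<lfloor>\<alpha>\<rfloor> div 2) > 0" "frac \<alpha> + 2 * real (nat (\<lfloor>\<alpha>\<rfloor> div 2)) = \<alpha>"
      using floor by (auto simp: frac_def)
    from besselK_polyp_iterated_integral[OF assms this]
    show "let n = nat (\<lfloor>\<alpha>\<rfloor> div 2);
           F = (\<lambda>\<tau> x. \<tau> powr frac \<alpha> * besselK_imag \<tau> x * exp (- x) * polyp n x / x)
       in iterated_integrable F \<and>
          (2 powr \<alpha> - 1) / (2 * pi) powr (\<alpha> - 1) * Gamma \<alpha> * riemann_zeta \<alpha>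
            = (-1) ^ nat (\<lfloor>\<alpha>\<rfloor> div 2) * iterated_integral F"
      by (simp only: Let_def)
  next
    assume "odd \<lfloor>\<alpha>\<rfloor>"
    then obtain m where m: "\<lfloor>\<alpha>\<rfloor> = 2 * m + 1" by (elim oddE)
    then have "nat ((\<lfloor>\<alpha>\<rfloor> + 1) div 2) > 0" "frac \<alpha> - 1 + 2 * real (nat ((\<lfloor>\<alpha>\<rfloor> + 1) div 2)) = \<alpha>"
      using floor by (auto simp: frac_def)
    from besselK_polyp_iterated_integral[OF assms this]
    show "let n = nat ((\<lfloor>\<alpha>\<rfloor> + 1) div 2);
           F = (\<lambda>\<tau> x. \<tau> powr (frac \<alpha> - 1) * besselK_imag \<tau> x * exp (- x) * polyp n x / x)
       in iterated_integrable F \<and>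
          (2 powr \<alpha> - 1) / (2 * pi) powr (\<alpha> - 1) * Gamma \<alpha> * riemann_zeta \<alpha>
            = (-1) ^ nat ((\<lfloor>\<alpha>\<rfloor> + 1) div 2) * iterated_integral F"
      by (simp only: Let_def)
  }
qed

end
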